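(* For all $\beta_1,\beta_2>1$ with $\beta_1\neq\beta_2$, the set of uniqueness $\mathcal U_{\beta_1,\beta_2}$ is non-empty.
   Context: Write $p=+1$, $m=-1$. For $\beta_1,\beta_2>1$ define $\pi:\{p,m\}^{\mathbb N}\to\mathbb R^2$ by $\pi(w)=\left(\sum_{i\ge1}w_i\beta_1^{-i},\sum_{i\ge1}w_i\beta_2^{-i}\right)$. Let $U_{\beta_1,\beta_2}$ be the set of unique addresses, i.e. of $w\in\{p,m\}^{\mathbb N}$ such that $\pi(w')\ne\pi(w)$ for every $w'\in\{p,m\}^{\mathbb N}$ with $w'\neq w$. The set of uniqueness is $\mathcal U_{\beta_1,\beta_2}=\pi(U_{\beta_1,\beta_2})$. *)

theory Defs
  imports "HOL-Analysis.Analysis"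
begin

text \<open>The letters are the real numbers p = 1 and m = -1. Sequences are indexed from 0, so that
  \<open>w i\<close> is the (i+1)-st letter of the word, and carries the weight with exponent -(i+1).\<close>

definition words :: "(nat \<Rightarrow> real) set" where
  "words = UNIV \<rightarrow> {1, -1}"

definition addr_proj :: "real \<Rightarrow> real \<Rightarrow> (nat \<Rightarrow> real) \<Rightarrow> real \<times> real" where
  "addr_proj \<beta>1 \<beta>2 w = (\<Sum>i. w i / \<beta>1 ^ Suc i, \<Sum>i. w i / \<beta>2 ^ Suc i)"

definition unique_addresses :: "real \<Rightarrow> real \<Rightarrow> (nat \<Rightarrow> real) set" where
  "unique_addresses \<beta>1 \<beta>2 =
     {w \<in> words. \<forall>w' \<in> words. w' \<noteq> w \<longrightarrow> addr_proj \<beta>1 \<beta>2 w' \<noteq> addr_proj \<beta>1 \<beta>2 w}"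

definition uniqueness_set :: "real \<Rightarrow> real \<Rightarrow> (real \<times> real) set" where
  "uniqueness_set \<beta>1 \<beta>2 = addr_proj \<beta>1 \<beta>2 ` unique_addresses \<beta>1 \<beta>2"

end

theory Submission
  imports Defs
begin

text \<open>A point at which a linear functional attains its maximum over all words has a unique address
  as soon as the functional gives non-zero weight to every letter. The first coordinate is such a
  functional: all its weights are positive, so its only maximiser is the constant word 1, and
  this word is therefore a unique address.\<close>

lemma word_letter:
  assumes "w \<in> words"
  shows "w i = 1 \<or> w i = -1"
  using assms unfolding words_def by blast

lemma summable_word_expansion:
  fixes \<beta> :: real
  assumes "\<beta> > 1" and "w \<in> words"
  shows "summable (\<lambda>i. w i / \<beta> ^ Suc i)"
proof (rule summable_comparison_test')
  show "summable (\<lambda>i. (1 / \<beta>) ^ Suc i)"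
    using assms(1) by (subst summable_Suc_iff) (simp add: summable_geometric)
  fix i
  have "\<bar>w i\<bar> = 1"
    using word_letter[OF assms(2), of i] by auto
  then show "norm (w i / \<beta> ^ Suc i) \<le> (1 / \<beta>) ^ Suc i"
    using assms(1) by (simp add: abs_mult power_divide)
qed

lemma word_expansion_less_constant_one:
  fixes \<beta> :: real
  assumes "\<beta> > 1" and "w \<in> words" and "w \<noteq> (\<lambda>_. 1)"
  shows "(\<Sum>i. w i / \<beta> ^ Suc i) < (\<Sum>i. 1 / \<beta> ^ Suc i)"
proof -
  have one: "(\<lambda>_. 1) \<in> words"
    by (simp add: words_def)
  note letter = word_letter[OF assms(2)]
  obtain k where "w k \<noteq> 1"
    using assms(3) by auto
  then have k: "w k = -1"
    using letter by blast
  let ?d = "\<lambda>i. 1 / \<beta> ^ Suc i - w i / \<beta> ^ Suc i"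
  note summable_one = summable_word_expansion[OF assms(1) one]
    and summable_w = summable_word_expansion[OF assms(1,2)]
  have "0 < (\<Sum>i. ?d i)"
  proof (rule suminf_pos2)
    show "summable ?d"
      using summable_one summable_w by (rule summable_diff)
    show "0 \<le> ?d i" for i
      using letter[of i] assms(1) by (auto simp: field_simps)
    show "0 < ?d k"
      using k assms(1) by (simp add: field_simps)
  qed
  then show ?thesis
    using suminf_diff[OF summable_one summable_w] by simp
qed

theorem lemma4p1:
  fixes \<beta>1 \<beta>2 :: real
  assumes "\<beta>1 > 1" and "\<beta>2 > 1" and "\<beta>1 \<noteq> \<beta>2"
  shows "uniqueness_set \<beta>1 \<beta>2 \<noteq> {}"
proof -
  have "addr_proj \<beta>1 \<beta>2 w' \<noteq> addr_proj \<beta>1 \<beta>2 (\<lambda>_. 1)"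
    if "w' \<in> words" and "w' \<noteq> (\<lambda>_. 1)" for w'
    using word_expansion_less_constant_one[OF assms(1) that]
    unfolding addr_proj_def prod.inject by linarith
  moreover have "(\<lambda>_. 1) \<in> words"
    by (simp add: words_def)
  ultimately have "(\<lambda>_. 1) \<in> unique_addresses \<beta>1 \<beta>2"
    unfolding unique_addresses_def by blast
  then show ?thesis
    unfolding uniqueness_set_def by blast
qed

end
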